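(* There exist a countable poset $P$ containing no infinite antichain and a positive integer $k$ such that there do not exist $k$ chains $C_1,\dotsc,C_k$ of $P$ together with a partition of $P$ into pairwise disjoint antichains $(A_i : i\in I)$ such that each $A_i$ meets $\min(|A_i|,k)$ of the chains $C_j$.
   Context: A chain in a poset is a set of pairwise comparable elements; an antichain is a set of pairwise incomparable elements. (This statement is the negation, for a particular countable poset, of the Aharoni–Korman conjecture: "if a poset $P$ contains no infinite antichain then, for every positive integer $k$, there exist $k$ chains $C_1,\dots,C_k$ and a partition of $P$ into disjoint antichains $(A_i)$ such that each $A_i$ meets $\min(|A_i|,k)$ chains $C_j$".) *)

theory Defs
  imports Main "HOL-Library.Countable_Set" "HOL-Library.Disjoint_Sets"
begin

definition antichain_of :: "'a set \<Rightarrow> ('a \<times> 'a) set \<Rightarrow> 'a set \<Rightarrow> bool" where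
  "antichain_of P r A \<longleftrightarrow> A \<subseteq> P \<and> (\<forall>x\<in>A. \<forall>y\<in>A. x \<noteq> y \<longrightarrow> (x, y) \<notin> r \<and> (y, x) \<notin> r)"

(* Chains may be empty and may overlap, and the chains met are counted by their indices.
   Members of Chains r lie in P automatically when partial_order_on P r holds.
   The cardinality card A is the true one as soon as P has no infinite antichain;
   partition_on excludes empty parts, for which the condition would be vacuous. *)
definition chain_antichain_property :: "'a set \<Rightarrow> ('a \<times> 'a) set \<Rightarrow> nat \<Rightarrow> bool" where
  "chain_antichain_property P r k \<longleftrightarrow>
     (\<exists>(C :: nat \<Rightarrow> 'a set) (\<A> :: 'a set set).
        (\<forall>j\<in>{1..k}. C j \<in> Chains r) \<and>
        partition_on P \<A> \<and>
        (\<forall>A\<in>\<A>. antichain_of P r A) \<and>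
        (\<forall>A\<in>\<A>. card {j\<in>{1..k}. A \<inter> C j \<noteq> {}} = min (card A) k))"

end

theory Submission
  imports Defs "HOL-Library.Nat_Bijection"
begin

text \<open>
  The poset is Hollom's: countably many copies (levels) of \<open>\<nat>\<^sup>2\<close>, where level \<open>n + 2\<close> lies entirely
  below level \<open>n\<close>, and \<open>(x, y)\<close> in level \<open>n + 1\<close> lies below \<open>(u, v)\<close> in level \<open>n\<close> iff
  \<open>min x y < min u v\<close> or \<open>x + y \<le> 2 (u + v)\<close>. We take \<open>k = 1\<close>. A chain \<open>C\<close> and a partition into
  antichains meeting \<open>C\<close> amount to a retraction \<open>f\<close> onto \<open>C\<close> whose fibres are antichains.

  If \<open>C\<close> were infinite on every level, the minimum coordinate of its points would strictly decrease
  from each level to the next; so \<open>C\<close> is finite on some level \<open>n\<close>. A point of level \<open>n\<close> sent up by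
  \<open>f\<close> has its coordinate sum at least halved, so counting along a horizontal ray shows that points
  with arbitrarily large minimum are sent down to level \<open>n + 1\<close>. This forces \<open>C\<close> to be empty on
  level \<open>n\<close> and to have unbounded minimum on level \<open>n + 1\<close>, and \<open>f\<close> to preserve level \<open>n + 1\<close> away
  from the axes. There each fibre over a point of \<open>C\<close> above a given \<open>(p, q) \<in> C\<close> meets the row of
  height \<open>q\<close>. A point of level \<open>n\<close> with minimum above \<open>q\<close> lies above that whole row, so it cannot be
  sent down: a contradiction.
\<close>

section \<open>The layered order: axioms and finiteness of antichains\<close>

fun hle :: "nat \<times> nat \<times> nat \<Rightarrow> nat \<times> nat \<times> nat \<Rightarrow> bool" where
  "hle (n, x, y) (m, u, v) \<longleftrightarrow>
     m + 2 \<le> n \<or> n = m \<and> x \<le> u \<and> y \<le> v \<or>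
     n = Suc m \<and> (min x y < min u v \<or> x + y \<le> 2 * (u + v))"

lemma hle_refl: "hle a a"
  by (cases a) auto

lemma hle_antisym: "hle a b \<Longrightarrow> hle b a \<Longrightarrow> a = b"
  by (cases a; cases b) auto

lemma hle_trans:
  assumes "hle a b" "hle b c"
  shows "hle a c"
proof -
  obtain n x y m u v k s t where "a = (n, x, y)" "b = (m, u, v)" "c = (k, s, t)"
    by (metis prod_cases3)
  moreover have "min x y \<le> min u v" if "x \<le> u" "y \<le> v" using that by linarith
  moreover have "min u v \<le> min s t" if "u \<le> s" "v \<le> t" using that by linarith
  ultimately show ?thesis using assms
    by (simp only: hle.simps) (elim disjE conjE; (simp; fail | linarith | auto))
qed

text \<open>Once one pair \<open>(x, y)\<close> is fixed, every pair has first coordinate at most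
  \<open>x\<close> or second at most \<open>y\<close>, and both projections are injective on
  \<open>B\<close>.\<close>

lemma finite_pairwise_incomparable_nat_pairs:
  fixes B :: "(nat \<times> nat) set"
  assumes "\<And>x y u v. (x, y) \<in> B \<Longrightarrow> (u, v) \<in> B \<Longrightarrow> x \<le> u \<Longrightarrow> y \<le> v \<Longrightarrow> x = u \<and> y = v"
  shows "finite B"
proof (cases "B = {}")
  case False
  then obtain x y where xy: "(x, y) \<in> B" by auto
  have inj: "inj_on fst B" "inj_on snd B"
    using assms nat_le_linear by (auto simp: inj_on_def; blast)+
  have "B \<subseteq> (fst -` {..x} \<inter> B) \<union> (snd -` {..y} \<inter> B)"
  proof clarsimp
    fix u v assume "(u, v) \<in> B" "\<not> v \<le> y"
    then show "u \<le> x" using assms[OF xy, of u v] by linarith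
  qed
  then show ?thesis
    by (rule finite_subset) (simp add: finite_vimage_IntI inj)
qed simp

text \<open>An element of level \<open>n\<close> is comparable with everything from level
  \<open>n + 2\<close> on, so \<open>A\<close> lives on finitely many levels.\<close>

lemma finite_hle_antichain:
  assumes anti: "\<And>a b. a \<in> A \<Longrightarrow> b \<in> A \<Longrightarrow> hle a b \<Longrightarrow> a = b"
  shows "finite A"
proof (cases "A = {}")
  case False
  then obtain n x y where a: "(n, x, y) \<in> A" by auto
  have "finite {p. (m, p) \<in> A}" for m
    by (rule finite_pairwise_incomparable_nat_pairs) (use anti in fastforce)
  then have "finite (SIGMA m:{..Suc n}. {p. (m, p) \<in> A})" by blast
  moreover have "m \<le> Suc n" if "(m, u, v) \<in> A" for m u v
    using anti[OF that a] by (cases "n + 2 \<le> m") auto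
  then have "A \<subseteq> (SIGMA m:{..Suc n}. {p. (m, p) \<in> A})" by force
  ultimately show ?thesis by (rule finite_subset[rotated])
qed simp

section \<open>Retractions onto a chain with antichain fibres\<close>

locale spine =
  fixes C :: "(nat \<times> nat \<times> nat) set" and f :: "nat \<times> nat \<times> nat \<Rightarrow> nat \<times> nat \<times> nat"
  assumes chain: "a \<in> C \<Longrightarrow> b \<in> C \<Longrightarrow> hle a b \<or> hle b a"
    and f_in: "f a \<in> C"
    and f_id: "a \<in> C \<Longrightarrow> f a = a"
    and f_inj: "f a = f b \<Longrightarrow> hle a b \<Longrightarrow> a = b"
begin

definition level :: "nat \<Rightarrow> (nat \<times> nat) set" where
  "level n = {p. (n, p) \<in> C}"

text \<open>\<open>f a\<close> lies in \<open>C\<close> and is therefore fixed, so \<open>a\<close>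
  and \<open>f a\<close> share a fibre.\<close>

lemma f_comparable: "hle a (f a) \<or> hle (f a) a \<Longrightarrow> f a = a"
  by (metis f_id f_in f_inj)

text \<open>Levels two or more apart are comparable, so \<open>f\<close> moves a point by at most
  one level; the inequalities negate \<open>hle\<close> between adjacent levels.\<close>

lemma f_cases:
  assumes "f (n, x, y) = (m, u, v)"
  obtains "m = n"
  | "n = Suc m" "min u v \<le> min x y" "2 * (u + v) < x + y"
  | "m = Suc n" "min x y \<le> min u v" "2 * (x + y) < u + v"
proof (cases "m = n")
  case False
  then have incomp: "\<not> hle (n, x, y) (m, u, v)" "\<not> hle (m, u, v) (n, x, y)"
    using f_comparable[of "(n, x, y)"] assms by auto
  then have "\<not> m + 2 \<le> n" "\<not> n + 2 \<le> m" by auto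
  with False consider "n = Suc m" | "m = Suc n" by linarith
  then show ?thesis
  proof cases
    case 1
    then show ?thesis using incomp(1) that(2) by (metis hle.simps not_less not_le)
  next
    case 2
    then show ?thesis using incomp(2) that(3) by (metis hle.simps not_less not_le)
  qed
qed

lemma f_in_level: "f a = (n, p) \<Longrightarrow> p \<in> level n"
  using f_in[of a] by (simp add: level_def)

lemma level_linear:
  "(x, y) \<in> level n \<Longrightarrow> (u, v) \<in> level n \<Longrightarrow> x \<le> u \<and> y \<le> v \<or> u \<le> x \<and> v \<le> y"
  unfolding level_def using chain[of "(n, x, y)" "(n, u, v)"] by auto

text \<open>Sums strictly increase along a chain of pairs; the counting arguments identify points of
  the chain by them.\<close>

lemma level_sum_inj:
  "(x, y) \<in> level n \<Longrightarrow> (u, v) \<in> level n \<Longrightarrow> x + y = u + v \<Longrightarrow> x = u \<and> y = v"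
  using level_linear[of x y n u v] by auto

lemma finite_fibre: "finite {a. f a = c}"
proof (rule finite_hle_antichain)
  fix a b assume "a \<in> {a. f a = c}" "b \<in> {a. f a = c}" "hle a b"
  then show "a = b" using f_inj[of a b] by simp
qed

lemma infinite_level_sum_unbounded:
  assumes "infinite (level n)"
  obtains x y where "(x, y) \<in> level n" "S < x + y"
proof -
  have "\<not> level n \<subseteq> {..S} \<times> {..S}"
    using assms finite_subset by blast
  then obtain x y where "(x, y) \<in> level n" "\<not> (x \<le> S \<and> y \<le> S)" by auto
  then show ?thesis using that[of x y] by auto
qed

lemma finite_level_sends_down:
  assumes fin: "finite (level n)"
  obtains x y u v where "K \<le> min x y" "f (n, x, y) = (Suc n, u, v)"
proof (rule ccontr)
  assume neg: "\<not> thesis"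
  \<comment> \<open>The row of height \<open>M\<close> will start beyond all of \<open>?X\<close>,
    so that \<open>f\<close> keeps none of its points on level \<open>n\<close>.\<close>
  have "finite ((\<lambda>a. fst (snd a)) ` (\<Union>p\<in>level n. {a. f a = (n, p)}))" (is "finite ?X")
    using fin finite_fibre by blast
  then obtain K' where K': "\<And>k. k \<in> ?X \<Longrightarrow> k \<le> K'"
    by (meson finite_nat_set_iff_bounded_le)
  define M where "M = Suc (K + K')"
  define h where "h i = (case f (n, M + i, M) of (m, u, v) \<Rightarrow> u + v)" for i
  have up: "\<exists>m u v. f (n, M + i, M) = (m, u, v) \<and> n = Suc m \<and> 2 * (u + v) < M + i + M" for i
  proof -
    obtain m u v where e: "f (n, M + i, M) = (m, u, v)" by (metis prod_cases3)
    have "m \<noteq> n"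
    proof
      assume "m = n"
      then have "M + i \<in> ?X" using f_in_level[OF e] e by (force simp: image_iff)
      then show False using K'[of "M + i"] by (simp add: M_def)
    qed
    moreover have "m \<noteq> Suc n" using neg that[of "M + i" M u v] e by (auto simp: M_def)
    ultimately show ?thesis using e by - (rule f_cases[OF e], auto)
  qed
  \<comment> \<open>Pigeonhole: \<open>2 * M + 1\<close> pairwise comparable points have distinct
    images, yet halving leaves only \<open>2 * M\<close> possible sums.\<close>
  have "inj_on h {..2 * M}"
  proof (rule inj_onI)
    fix i j assume "h i = h j"
    moreover obtain m u v where 1: "f (n, M + i, M) = (m, u, v)" "n = Suc m" using up by blast
    moreover obtain m' u' v' where 2: "f (n, M + j, M) = (m', u', v')" "n = Suc m'" using up by blast
    ultimately have "f (n, M + i, M) = f (n, M + j, M)"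
      using level_sum_inj[of u v m u' v'] f_in_level by (auto simp: h_def)
    then show "i = j"
      using f_inj[of "(n, M + i, M)" "(n, M + j, M)"] f_inj[of "(n, M + j, M)" "(n, M + i, M)"]
      by (cases "i \<le> j") auto
  qed
  moreover have "h ` {..2 * M} \<subseteq> {..<2 * M}"
  proof clarify
    fix i assume "i \<le> 2 * M"
    then show "h i < 2 * M" using up[of i] by (auto simp: h_def)
  qed
  ultimately show False using card_inj_on_le[of h "{..2 * M}" "{..<2 * M}"] by simp
qed

text \<open>A point far up level \<open>Suc n\<close> lies above \<open>(x, y)\<close> and is too
  large for the sum clause of \<open>hle\<close>; only the clause on minima can place it below
  \<open>(u, v)\<close>.\<close>

lemma infinite_level_min_less:
  assumes "infinite (level (Suc n))" "(x, y) \<in> level (Suc n)" "(u, v) \<in> level n"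
  shows "min x y < min u v"
proof (rule ccontr)
  assume ge: "\<not> min x y < min u v"
  obtain x' y' where xy': "(x', y') \<in> level (Suc n)" "x + y + 2 * (u + v) < x' + y'"
    using infinite_level_sum_unbounded[OF assms(1)] .
  then have "x \<le> x'" "y \<le> y'" using level_linear[OF assms(2) xy'(1)] by auto
  then show False
    using chain[of "(Suc n, x', y')" "(n, u, v)"] xy' assms(3) ge by (auto simp: level_def)
qed

lemma ex_finite_level: "\<exists>n. finite (level n)"
proof (rule ccontr)
  assume "\<nexists>n. finite (level n)"
  then have inf: "infinite (level n)" for n by blast
  have "\<exists>p. p \<in> level n" for n using inf[of n] by (metis ex_in_conv infinite_imp_nonempty)
  then obtain g where g: "g n \<in> level n" for n by metis
  define \<mu> where "\<mu> n = min (fst (g n)) (snd (g n))" for n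
  have dec: "\<mu> (Suc n) < \<mu> n" for n
    unfolding \<mu>_def using g by (intro infinite_level_min_less inf) auto
  have "\<mu> n + n \<le> \<mu> 0" for n
  proof (induction n)
    case (Suc n)
    then show ?case using dec[of n] by simp
  qed simp
  from this[of "Suc (\<mu> 0)"] show False by simp
qed

text \<open>Along a lattice path from \<open>(p, q)\<close> to a distant point of the chain,
  \<open>f\<close> permutes the coordinate sums, so the fibre of \<open>(a, b)\<close> meets the
  path. Being finite, the fibre misses distant vertical segments, which leaves the row.\<close>

lemma fibre_meets_row:
  assumes pres: "\<And>x y. K \<le> min x y \<Longrightarrow> fst (f (n, x, y)) = n"
    and unb: "\<And>N. \<exists>u v. (u, v) \<in> level n \<and> N \<le> min u v"
    and c0: "(p, q) \<in> level n" "K \<le> min p q"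
    and c: "(a, b) \<in> level n" "p \<le> a" "q \<le> b"
  obtains x where "f (n, x, q) = (n, a, b)"
proof (rule ccontr)
  assume neg: "\<not> thesis"
  have far: "\<exists>u y. N \<le> u \<and> f (n, u, y) = (n, a, b)" for N
  proof -
    obtain u v where uv: "(u, v) \<in> level n" "N + a + b \<le> min u v" using unb by blast
    \<comment> \<open>the path from \<open>(p, q)\<close> right to \<open>(u, q)\<close> and then up to \<open>(u, v)\<close>, indexed by the coordinate sum\<close>
    define g where "g s = (if s \<le> u + q then (n, s - q, q) else (n, u, s - u))" for s
    define h where "h s = (case f (g s) of (_, x, y) \<Rightarrow> x + y)" for s
    define I where "I = {p + q..u + v}"
    \<comment> \<open>An image outside the rectangle from \<open>(p, q)\<close> to
      \<open>(u, v)\<close> would be comparable with its preimage, hence equal to it, but the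
      preimage is inside.\<close>
    have img: "\<exists>x y. f (g s) = (n, x, y) \<and> p \<le> x \<and> q \<le> y \<and> x \<le> u \<and> y \<le> v" if s: "s \<in> I" for s
    proof -
      obtain i j where g: "g s = (n, i, j)" and ij: "p \<le> i" "q \<le> j" "i \<le> u" "j \<le> v"
        using that[of "s - q" q] that[of u "s - u"] s c uv
        by (cases "s \<le> u + q") (auto simp: g_def I_def)
      then obtain x y where e: "f (n, i, j) = (n, x, y)"
        using pres[of i j] c0(2) by (metis min.mono order_trans prod.collapse)
      have xy: "(x, y) \<in> level n" using f_in_level[OF e] .
      have cmp: "x = i \<and> y = j" if "i \<le> x \<and> j \<le> y \<or> x \<le> i \<and> y \<le> j"
        using f_comparable[of "(n, i, j)"] e that by auto
      have "p \<le> x \<and> q \<le> y" using level_linear[OF xy c0(1)] cmp ij by auto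
      moreover have "x \<le> u \<and> y \<le> v" using level_linear[OF xy uv(1)] cmp ij by auto
      ultimately show ?thesis using g e by auto
    qed
    have f_eq: "f (g s) = (n, x, y)" if s: "s \<in> I" "(x, y) \<in> level n" "h s = x + y" for s x y
    proof -
      obtain x' y' where e: "f (g s) = (n, x', y')" using img[OF s(1)] by blast
      then have "x' + y' = x + y" using s(3) by (simp add: h_def)
      then show ?thesis using level_sum_inj[OF f_in_level[OF e] s(2)] e by simp
    qed
    have "inj_on h I"
    proof (rule linorder_inj_onI')
      fix s t assume st: "s \<in> I" "t \<in> I" "s < t"
      show "h s \<noteq> h t"
      proof
        assume eq: "h s = h t"
        obtain x y where e: "f (g t) = (n, x, y)" using img[OF st(2)] by blast
        then have "h s = x + y" using eq by (simp add: h_def)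
        then have "f (g s) = f (g t)" using f_eq[OF st(1) f_in_level[OF e]] e by simp
        moreover have "hle (g s) (g t)" "g s \<noteq> g t" using st c uv by (auto simp: g_def I_def)
        ultimately show False using f_inj by blast
      qed
    qed
    moreover have "h ` I \<subseteq> I"
    proof clarify
      fix s assume "s \<in> I"
      then show "h s \<in> I" using img[of s] by (auto simp: h_def I_def)
    qed
    ultimately have "h ` I = I" by (simp add: endo_inj_surj I_def)
    moreover have "a + b \<in> I" using c uv by (auto simp: I_def)
    ultimately obtain s where s: "s \<in> I" "h s = a + b" by (metis imageE)
    have fs: "f (g s) = (n, a, b)" using f_eq[OF s(1) c(1) s(2)] .
    then have "g s = (n, u, s - u)" using neg that[of "s - q"] by (auto simp: g_def split: if_splits)
    then show ?thesis using fs uv by (intro exI[of _ u] exI[of _ "s - u"]) auto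
  qed
  have "finite ((\<lambda>a. fst (snd a)) ` {d. f d = (n, a, b)})" (is "finite ?X")
    using finite_fibre by blast
  then obtain N where "\<And>k. k \<in> ?X \<Longrightarrow> k \<le> N"
    by (meson finite_nat_set_iff_bounded_le)
  moreover obtain u y where "Suc N \<le> u" "f (n, u, y) = (n, a, b)" using far by blast
  ultimately show False by (force simp: image_iff)
qed

lemma no_spine: False
proof -
  obtain n where n: "finite (level n)" using ex_finite_level by blast
  have down: "\<exists>x y u v. K \<le> min x y \<and> f (n, x, y) = (Suc n, u, v) \<and> (u, v) \<in> level (Suc n) \<and>
      min x y \<le> min u v" for K
  proof -
    obtain x y u v where 1: "K \<le> min x y" "f (n, x, y) = (Suc n, u, v)"
      using finite_level_sends_down[OF n] .
    then show ?thesis using f_in_level[OF 1(2)] by - (rule f_cases[OF 1(2)], auto)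
  qed
  then have unb: "\<exists>u v. (u, v) \<in> level (Suc n) \<and> N \<le> min u v" for N
    by (meson order_trans)
  have inf: "infinite (level (Suc n))"
  proof
    assume "finite (level (Suc n))"
    then have "finite ((\<lambda>(u, v). min u v) ` level (Suc n))" by blast
    then obtain N where "\<And>k. k \<in> (\<lambda>(u, v). min u v) ` level (Suc n) \<Longrightarrow> k \<le> N"
      by (meson finite_nat_set_iff_bounded_le)
    then show False using unb[of "Suc N"] by fastforce
  qed
  have empty: "level n = {}"
  proof (rule ccontr)
    assume "level n \<noteq> {}"
    then obtain a b where "(a, b) \<in> level n" by auto
    then show False using unb[of "min a b"] infinite_level_min_less[OF inf] by (meson not_le)
  qed
  \<comment> \<open>If this level is infinite, any single point of level \<open>Suc n\<close> bounds
    its minima.\<close>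
  obtain B where B: "\<And>x y. (x, y) \<in> level (Suc (Suc n)) \<Longrightarrow> min x y < B"
  proof (cases "finite (level (Suc (Suc n)))")
    case True
    then have "finite ((\<lambda>(u, v). min u v) ` level (Suc (Suc n)))" by blast
    then show ?thesis using that by (force simp: finite_nat_set_iff_bounded)
  next
    case False
    then show ?thesis using that infinite_level_min_less unb by meson
  qed
  \<comment> \<open>Moving up is impossible since level \<open>n\<close> is empty; moving down would
    not decrease the minimum, against the bound \<open>B\<close>.\<close>
  have pres: "fst (f (Suc n, x, y)) = Suc n" if "B \<le> min x y" for x y
  proof -
    obtain m u v where e: "f (Suc n, x, y) = (m, u, v)" by (metis prod_cases3)
    have "m \<noteq> n" using empty f_in_level[OF e] by auto
    moreover have False if "m = Suc (Suc n)" "min x y \<le> min u v"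
      using B[of u v] f_in_level[OF e] that \<open>B \<le> min x y\<close> by simp
    ultimately show ?thesis using e by - (rule f_cases[OF e], auto)
  qed
  obtain p q where pq: "(p, q) \<in> level (Suc n)" "B \<le> min p q" using unb by blast
  \<comment> \<open>The bound \<open>Suc q\<close> puts \<open>(n, x, y)\<close> above the whole row
    of height \<open>q\<close> on level \<open>Suc n\<close>.\<close>
  obtain x y u v where xy: "Suc q \<le> min x y" "f (n, x, y) = (Suc n, u, v)"
    and uv: "(u, v) \<in> level (Suc n)" "min x y \<le> min u v"
    using down by blast
  have "p \<le> u" "q \<le> v" using level_linear[OF pq(1) uv(1)] xy uv by auto
  then obtain z where z: "f (Suc n, z, q) = (Suc n, u, v)"
    using fibre_meets_row[OF pres unb pq uv(1)] by blast
  have "hle (Suc n, z, q) (n, x, y)" using xy by auto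
  then show False using f_inj[of "(Suc n, z, q)" "(n, x, y)"] z xy by auto
qed

end

section \<open>From a chain and a partition to a retraction\<close>

lemma chain_antichain_property_1_retraction:
  assumes property: "chain_antichain_property P r 1"
    and fin: "\<And>A. antichain_of P r A \<Longrightarrow> finite A"
    and r: "r \<subseteq> P \<times> P"
  obtains C f where "C \<in> Chains r" "\<And>x. x \<in> P \<Longrightarrow> f x \<in> C" "\<And>x. x \<in> C \<Longrightarrow> f x = x"
    "\<And>x y. f x = f y \<Longrightarrow> (x, y) \<in> r \<Longrightarrow> x = y"
proof -
  obtain D :: "nat \<Rightarrow> 'a set" and \<A> where D: "D 1 \<in> Chains r" and part: "partition_on P \<A>"
    and anti: "\<And>A. A \<in> \<A> \<Longrightarrow> antichain_of P r A"
    and meet: "\<And>A. A \<in> \<A> \<Longrightarrow> card {j\<in>{1..1}. A \<inter> D j \<noteq> {}} = min (card A) 1"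
    using property unfolding chain_antichain_property_def by auto
  have meets: "\<exists>c. c \<in> D 1 \<and> c \<in> A" if A: "A \<in> \<A>" for A
  proof -
    have "A \<noteq> {}" using part A by (auto simp: partition_on_def)
    \<comment> \<open>Finiteness matters here: an infinite part would have \<open>card\<close>
      0.\<close>
    then have "min (card A) 1 = 1" using fin[OF anti[OF A]] by (simp add: Suc_le_eq card_gt_0_iff)
    then have "{j\<in>{1..1}. A \<inter> D j \<noteq> {}} \<noteq> {}" using meet[OF A] by (metis card.empty zero_neq_one)
    then show ?thesis by auto
  qed
  have parts: "\<exists>A\<in>\<A>. x \<in> A" if "x \<in> P" for x
    using part that by (auto simp: partition_on_def)
  have same: "A = A'" if "A \<in> \<A>" "A' \<in> \<A>" "c \<in> A" "c \<in> A'" for A A' c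
    using part that by (auto simp: partition_on_def disjoint_def)
  \<comment> \<open>The choice depends only on the part of \<open>x\<close>, since a chain meets an
    antichain at most once.\<close>
  define f where "f x = (SOME c. c \<in> D 1 \<and> (\<exists>A\<in>\<A>. x \<in> A \<and> c \<in> A))" for x
  have f: "f x \<in> D 1 \<and> (\<exists>A\<in>\<A>. x \<in> A \<and> f x \<in> A)" if "x \<in> P" for x
    unfolding f_def by (rule someI_ex) (use meets parts[OF that] in blast)
  show ?thesis
  proof
    show "D 1 \<in> Chains r" by fact
    show "f x \<in> D 1" if "x \<in> P" for x using f[OF that] by blast
    show "f x = x" if x: "x \<in> D 1" for x
    proof -
      have "(x, x) \<in> r" using D x by (auto simp: Chains_def)
      then obtain A where A: "A \<in> \<A>" "x \<in> A" "f x \<in> A" and fx: "f x \<in> D 1" using f[of x] r by blast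
      have "(f x, x) \<in> r \<or> (x, f x) \<in> r" using D x fx by (auto simp: Chains_def)
      then show ?thesis using anti[OF A(1)] A(2,3) by (auto simp: antichain_of_def)
    qed
    show "x = y" if eq: "f x = f y" and xy: "(x, y) \<in> r" for x y
    proof -
      have P: "x \<in> P" "y \<in> P" using xy r by auto
      obtain A where A: "A \<in> \<A>" "x \<in> A" "f x \<in> A" using f[OF P(1)] by blast
      obtain A' where A': "A' \<in> \<A>" "y \<in> A'" "f y \<in> A'" using f[OF P(2)] by blast
      have "y \<in> A" using same[OF A(1) A'(1) A(3)] A' eq by simp
      then show ?thesis using anti[OF A(1)] A(2) xy by (auto simp: antichain_of_def)
    qed
  qed
qed

(* Every countable poset is isomorphic to one carried by a set of natural numbers. *)
theorem mainTheorem1: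
  shows "\<exists>(P :: nat set) (r :: (nat \<times> nat) set) (k :: nat).
           countable P \<and> partial_order_on P r \<and>
           (\<nexists>A. antichain_of P r A \<and> infinite A) \<and>
           k > 0 \<and>
           \<not> chain_antichain_property P r k"
proof -
  \<comment> \<open>Decoding twice turns naturals into triples, which carries the order over to
    \<open>nat\<close>.\<close>
  define e :: "nat \<Rightarrow> nat \<times> nat \<times> nat" where "e = map_prod id prod_decode \<circ> prod_decode"
  have e: "bij e"
    unfolding e_def
    by (intro bij_comp bij_prod_decode bijI prod.inj_map map_prod_surj)
      (simp_all add: inj_prod_decode surj_prod_decode)
  define r where "r = {(i, j). hle (e i) (e j)}"
  have po: "partial_order_on UNIV r"
    unfolding partial_order_on_def preorder_on_def
  proof (intro conjI)
    show "refl_on UNIV r" by (auto simp: refl_on_def r_def hle_refl)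
    show "trans r" by (rule transI) (simp add: r_def, rule hle_trans)
    show "antisym r"
      by (rule antisymI) (simp add: r_def, metis hle_antisym injD[OF bij_is_inj[OF e]])
  qed simp
  have fin: "finite A" if "antichain_of UNIV r A" for A
  proof -
    have "finite (e ` A)"
    proof (rule finite_hle_antichain)
      fix a b assume "a \<in> e ` A" "b \<in> e ` A" "hle a b"
      then obtain i j where ij: "a = e i" "b = e j" "i \<in> A" "j \<in> A" "(i, j) \<in> r"
        unfolding r_def by blast
      then have "i = j" using that unfolding antichain_of_def by blast
      then show "a = b" using ij by simp
    qed
    then show ?thesis using bij_is_inj[OF e] by (meson finite_imageD inj_on_subset subset_UNIV)
  qed
  have "\<not> chain_antichain_property UNIV r 1"
  proof
    assume property: "chain_antichain_property UNIV r 1"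
    have "r \<subseteq> UNIV \<times> UNIV" by simp
    then obtain C f where C: "C \<in> Chains r" and f: "\<And>x. x \<in> UNIV \<Longrightarrow> f x \<in> C" "\<And>x. x \<in> C \<Longrightarrow> f x = x"
      "\<And>x y. f x = f y \<Longrightarrow> (x, y) \<in> r \<Longrightarrow> x = y"
      using chain_antichain_property_1_retraction[OF property fin] by blast
    have inv: "inv e (e x) = x" "e (inv e y) = y" for x y
      using e by (simp_all add: bij_is_inj bij_is_surj surj_f_inv_f)
    interpret spine "e ` C" "e \<circ> f \<circ> inv e"
    proof
      show "hle a b \<or> hle b a" if "a \<in> e ` C" "b \<in> e ` C" for a b
        using C that by (auto simp: Chains_def r_def)
      show "(e \<circ> f \<circ> inv e) a \<in> e ` C" for a using f(1) by simp
      show "(e \<circ> f \<circ> inv e) a = a" if "a \<in> e ` C" for a using f(2) that inv by auto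
      show "a = b" if "(e \<circ> f \<circ> inv e) a = (e \<circ> f \<circ> inv e) b" "hle a b" for a b
      proof -
        have "e (f (inv e a)) = e (f (inv e b))" using that(1) by simp
        then have "f (inv e a) = f (inv e b)" by (rule injD[OF bij_is_inj[OF e]])
        moreover have "(inv e a, inv e b) \<in> r" using that(2) by (simp add: r_def inv)
        ultimately have "inv e a = inv e b" by (rule f(3))
        then show ?thesis using inv(2) by metis
      qed
    qed
    show False by (rule no_spine)
  qed
  then show ?thesis
    using po fin by (intro exI[of _ UNIV] exI[of _ r] exI[of _ 1]) auto
qed

end
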